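(* Let $\{g_{S}: S\in\mathrm{Tab}_\tau\}$ be a basis for a space of polynomials of isotype $\tau$ for $\mathcal{H}_N(t)$. Then the linear map $$\rho:\mathcal{P}_\tau\to\mathcal{P},\qquad \sum_{S\in\mathrm{Tab}_\tau} f_{S}(x)\otimes S\ \longmapsto\ \sum_{S\in\mathrm{Tab}_\tau} f_{S}(x)\,g_{S}(x)$$ intertwines $\mathbf T_i$ with $T_i$ for $1\le i<N$; that is, $\mathbf T_i\,\rho=\rho\,T_i$ (operators act on the right).
   Context: Tableaux. Let $N\ge 2$ and let $\tau$ be a partition of $N$. Its Ferrers diagram is the set of boxes $(i,j)$ (row $i$, column $j$), $1\le i\le \ell(\tau)$, $1\le j\le\tau_i$. $\mathrm{Tab}_\tau$ is the set of reverse standard Young tableaux of shape $\tau$: fillings of the boxes by $1,\dots,N$, each used once, decreasing along each row (as $j$ increases) and along each column (as $i$ increases). For $S\in\mathrm{Tab}_\tau$ the entry $k$ is in box $(\mathrm{row}_S[k],\mathrm{col}_S[k])$ and its content is $c_S[k]=\mathrm{col}_S[k]-\mathrm{row}_S[k]$. $S^{(i)}$ is the tableau obtained from $S$ by exchanging $i$ and $i+1$. Let $\mathbb F$ be an extension field of $\mathbb C$ containing a formal parameter $t$ (transcendental over $\mathbb C$), and $V_\tau$ the $\mathbb F$-vector space with basis $\mathrm{Tab}_\tau$. All operators act on the right. The Hecke algebra $\mathcal H_N(t)$ is generated by $T_1,\dots,T_{N-1}$ with relations $(T_i+1)(T_i-t)=0$, $T_iT_{i+1}T_i=T_{i+1}T_iT_{i+1}$,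 and $T_iT_j=T_jT_i$ for $|i-j|>1$. The representation $\tau$ of $\mathcal H_N(t)$ on $V_\tau$ is given, with $b=c_S[i]-c_S[i+1]$, by: (I) if $\mathrm{row}_S[i]=\mathrm{row}_S[i+1]$, $S\tau(T_i)=tS$; (II) if $\mathrm{col}_S[i]=\mathrm{col}_S[i+1]$, $S\tau(T_i)=-S$; (III) if $\mathrm{row}_S[i]<\mathrm{row}_S[i+1]$ and $\mathrm{col}_S[i]>\mathrm{col}_S[i+1]$, $S\tau(T_i)=S^{(i)}+\frac{t-1}{1-t^{-b}}S$; (IV) if $b\le -2$, $S\tau(T_i)=\frac{t(t^{b+1}-1)(t^{b-1}-1)}{(t^b-1)^2}S^{(i)}+\frac{t^b(t-1)}{t^b-1}S$. $\mathcal P=\mathbb F[x_1,\dots,x_N]$; $p(xs_i)$ denotes $p$ with $x_i,x_{i+1}$ exchanged. $\mathcal H_N(t)$ acts on $\mathcal P$ by $pT_i=(1-t)x_{i+1}\frac{p(x)-p(xs_i)}{x_i-x_{i+1}}+t\,p(xs_i)$. On $\mathcal P_\tau=\mathcal P\otimes V_\tau$ define $(f\otimes S)\mathbf T_i=(1-t)x_{i+1}\frac{f(x)-f(xs_i)}{x_i-x_{i+1}}\otimes S+f(xs_i)\otimes S\tau(T_i)$. A basis $\{g_S:S\in\mathrm{Tab}_\tau\}$ of an $\mathcal H_N(t)$-invariant space of polynomials is a basis for a space of polynomials of isotype $\tau$ for $\mathcal H_N(t)$ if each $g_S T_i$ is given by the formulas (I)–(IV) with $S$, $S^{(i)}$ replaced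 by $g_S$, $g_{S^{(i)}}$. *)

theory Defs
  imports
    Complex_Main
    "HOL-Library.Poly_Mapping"
    "HOL-Library.FuncSet"
    "HOL-Combinatorics.Transposition"
    "HOL-Computational_Algebra.Polynomial"
begin

section \<open>The ground field\<close>

text \<open>The type \<open>'f\<close> is an extension field of the complex numbers by means of a ring homomorphism
  \<open>\<iota>\<close>, which is injective because its domain is a field.\<close>

definition complex_embedding :: "(complex \<Rightarrow> 'f::field) \<Rightarrow> bool" where
  "complex_embedding \<iota> \<longleftrightarrow>
     \<iota> 1 = 1 \<and> (\<forall>a b. \<iota> (a + b) = \<iota> a + \<iota> b) \<and> (\<forall>a b. \<iota> (a * b) = \<iota> a * \<iota> b)"

definition transcendental_over_complex :: "(complex \<Rightarrow> 'f::field) \<Rightarrow> 'f \<Rightarrow> bool" where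
  "transcendental_over_complex \<iota> t \<longleftrightarrow> (\<forall>p. p \<noteq> 0 \<longrightarrow> poly (map_poly \<iota> p) t \<noteq> 0)"

section \<open>Partitions and reverse standard Young tableaux\<close>

definition partition_of :: "nat \<Rightarrow> nat list \<Rightarrow> bool" where
  "partition_of N \<tau> \<longleftrightarrow> sorted_wrt (\<ge>) \<tau> \<and> 0 \<notin> set \<tau> \<and> sum_list \<tau> = N"

text \<open>Boxes are pairs (row, column), both counted from 1, whereas lists are indexed from 0.\<close>

definition diagram :: "nat list \<Rightarrow> (nat \<times> nat) set" where
  "diagram \<tau> = {(i, j). 1 \<le> i \<and> i \<le> length \<tau> \<and> 1 \<le> j \<and> j \<le> \<tau> ! (i - 1)}"

type_synonym tableau = "nat \<times> nat \<Rightarrow> nat"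

text \<open>Fillings are extensional, so that two fillings are equal iff they agree on the diagram.\<close>

definition Tab :: "nat list \<Rightarrow> tableau set" where
  "Tab \<tau> = {S. S \<in> extensional (diagram \<tau>) \<and> bij_betw S (diagram \<tau>) {1..sum_list \<tau>}
     \<and> (\<forall>i j j'. (i, j) \<in> diagram \<tau> \<and> (i, j') \<in> diagram \<tau> \<and> j < j' \<longrightarrow> S (i, j') < S (i, j))
     \<and> (\<forall>i i' j. (i, j) \<in> diagram \<tau> \<and> (i', j) \<in> diagram \<tau> \<and> i < i' \<longrightarrow> S (i', j) < S (i, j))}"

definition box_of :: "nat list \<Rightarrow> tableau \<Rightarrow> nat \<Rightarrow> nat \<times> nat" where
  "box_of \<tau> S k = the_inv_into (diagram \<tau>) S k"

definition row :: "nat list \<Rightarrow> tableau \<Rightarrow> nat \<Rightarrow> nat" where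
  "row \<tau> S k = fst (box_of \<tau> S k)"

definition col :: "nat list \<Rightarrow> tableau \<Rightarrow> nat \<Rightarrow> nat" where
  "col \<tau> S k = snd (box_of \<tau> S k)"

definition content :: "nat list \<Rightarrow> tableau \<Rightarrow> nat \<Rightarrow> int" where
  "content \<tau> S k = int (col \<tau> S k) - int (row \<tau> S k)"

definition exchange :: "nat list \<Rightarrow> nat \<Rightarrow> tableau \<Rightarrow> tableau" where
  "exchange \<tau> i S = restrict (transpose i (i + 1) \<circ> S) (diagram \<tau>)"

lemma finite_diagram: "finite (diagram \<tau>)"
proof (rule finite_subset)
  show "diagram \<tau> \<subseteq> {1..length \<tau>} \<times> {1..sum_list \<tau>}"
  proof
    fix b assume "b \<in> diagram \<tau>"
    then obtain i j where b: "b = (i, j)" and ij: "1 \<le> i" "i \<le> length \<tau>" "1 \<le> j" "j \<le> \<tau> ! (i - 1)"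
      by (auto simp: diagram_def)
    have "\<tau> ! (i - 1) \<le> sum_list \<tau>"
      using ij by (intro elem_le_sum_list) auto
    with ij b show "b \<in> {1..length \<tau>} \<times> {1..sum_list \<tau>}" by auto
  qed
qed simp

lemma finite_Tab: "finite (Tab \<tau>)"
proof (rule finite_subset)
  show "Tab \<tau> \<subseteq> diagram \<tau> \<rightarrow>\<^sub>E {1..sum_list \<tau>}"
    by (auto simp: Tab_def PiE_def bij_betw_def)
qed (simp add: finite_PiE finite_diagram)

section \<open>Polynomials\<close>

text \<open>Multivariate polynomials are finitely supported functions from monomials (exponent vectors)
  to coefficients. The variables are indexed by all natural numbers; \<open>Polys N\<close> is the subring of
  polynomials in the variables \<open>X 1, \<dots>, X N\<close>.\<close>

type_synonym 'f mpoly = "(nat \<Rightarrow>\<^sub>0 nat) \<Rightarrow>\<^sub>0 'f"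

definition Polys :: "nat \<Rightarrow> 'f::zero mpoly set" where
  "Polys N = {p. \<forall>m \<in> Poly_Mapping.keys p. Poly_Mapping.keys m \<subseteq> {1..N}}"

definition Const :: "'f::zero \<Rightarrow> 'f mpoly" where
  "Const c = Poly_Mapping.single 0 c"

definition X :: "nat \<Rightarrow> 'f::{zero,one} mpoly" where
  "X k = Poly_Mapping.single (Poly_Mapping.single k 1) 1"

definition poly_scale :: "'f::field \<Rightarrow> 'f mpoly \<Rightarrow> 'f mpoly" where
  "poly_scale c p = Const c * p"

global_interpretation poly_space: vector_space "poly_scale :: 'f::field \<Rightarrow> 'f mpoly \<Rightarrow> 'f mpoly"
  by unfold_locales
    (simp_all add: poly_scale_def Const_def algebra_simps single_add mult_single
      flip: mult.assoc)

text \<open>\<open>swap i p\<close> is \<open>p (x s\<^sub>i)\<close>: the coefficient of a monomial in \<open>swap i p\<close> is the coefficient in \<open>p\<close>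
  of the monomial with the exponents of \<open>X i\<close> and \<open>X (i + 1)\<close> exchanged.\<close>

definition swap :: "nat \<Rightarrow> 'f::zero mpoly \<Rightarrow> 'f mpoly" where
  "swap i p = Poly_Mapping.map_key (Poly_Mapping.map_key (transpose i (i + 1))) p"

text \<open>The quotient of \<open>p (x) - p (x s\<^sub>i)\<close> by \<open>x\<^sub>i - x\<^sub>i\<^sub>+\<^sub>1\<close>; it exists uniquely by
  \<open>div_diff_unique_exists\<close> below.\<close>

definition div_diff :: "nat \<Rightarrow> 'f::field mpoly \<Rightarrow> 'f mpoly" where
  "div_diff i p = (THE q. q * (X i - X (i + 1)) = p - swap i p)"

lemma inj_map_key_transpose:
  "inj (Poly_Mapping.map_key (transpose i (j::nat)) :: (nat \<Rightarrow>\<^sub>0 nat) \<Rightarrow> _)"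
proof (rule injI)
  fix m n :: "nat \<Rightarrow>\<^sub>0 nat"
  assume eq: "Poly_Mapping.map_key (transpose i j) m = Poly_Mapping.map_key (transpose i j) n"
  have "Poly_Mapping.lookup m (transpose i j (transpose i j k)) =
        Poly_Mapping.lookup n (transpose i j (transpose i j k))" for k
    using arg_cong[OF eq, of "\<lambda>q. Poly_Mapping.lookup q (transpose i j k)"]
    by (simp add: map_key.rep_eq)
  then show "m = n" by (intro poly_mapping_eqI) simp
qed

lemma lookup_swap:
  "Poly_Mapping.lookup (swap i p) m =
     Poly_Mapping.lookup p (Poly_Mapping.map_key (transpose i (i + 1)) m)"
  unfolding swap_def by (simp only: map_key.rep_eq inj_map_key_transpose if_True o_apply)

lemma swap_add: "swap i (p + q) = swap i p + swap i q"
  by (rule poly_mapping_eqI) (simp add: lookup_swap lookup_add)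

lemma swap_monomial:
  "swap i (Poly_Mapping.single m c) =
     Poly_Mapping.single (Poly_Mapping.map_key (transpose i (i + 1)) m) c"
proof (rule poly_mapping_eqI)
  fix n
  have "Poly_Mapping.map_key (transpose i (i + 1)) (Poly_Mapping.map_key (transpose i (i + 1)) k) = k"
    for k :: "nat \<Rightarrow>\<^sub>0 nat"
    by (rule poly_mapping_eqI) (simp add: map_key.rep_eq)
  then have "m = Poly_Mapping.map_key (transpose i (i + 1)) n \<longleftrightarrow>
      Poly_Mapping.map_key (transpose i (i + 1)) m = n" by metis
  then show "Poly_Mapping.lookup (swap i (Poly_Mapping.single m c)) n =
      Poly_Mapping.lookup (Poly_Mapping.single (Poly_Mapping.map_key (transpose i (i + 1)) m) c) n"
    by (simp only: lookup_swap lookup_single)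
qed

lemma X_power: "(X k :: 'f::comm_ring_1 mpoly) ^ n = Poly_Mapping.single (Poly_Mapping.single k n) 1"
proof (induction n)
  case (Suc n)
  then show ?case by (simp add: X_def mult_single flip: single_add)
qed simp

lemma X_diff_dvd_monomial:
  "(X i - X (i + 1) :: 'f::field mpoly) dvd
     Poly_Mapping.single m c - swap i (Poly_Mapping.single m c)"
proof -
  let ?x = "X i :: 'f mpoly" and ?y = "X (i + 1) :: 'f mpoly"
  define a b where "a = Poly_Mapping.lookup m i" and "b = Poly_Mapping.lookup m (i + 1)"
  define m0 where "m0 = Poly_Mapping.update i 0 (Poly_Mapping.update (i + 1) 0 m)"
  have m: "m = m0 + Poly_Mapping.single i a + Poly_Mapping.single (i + 1) b"
    by (rule poly_mapping_eqI)
      (auto simp: m0_def a_def b_def lookup_add lookup_single lookup_update when_def)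
  have m': "Poly_Mapping.map_key (transpose i (i + 1)) m =
      m0 + Poly_Mapping.single i b + Poly_Mapping.single (i + 1) a"
    by (rule poly_mapping_eqI)
      (auto simp: m0_def a_def b_def lookup_add lookup_single lookup_update when_def
        map_key.rep_eq transpose_def)
  have mono: "Poly_Mapping.single (m0 + Poly_Mapping.single i k + Poly_Mapping.single (i + 1) l) c =
      Poly_Mapping.single m0 c * (?x ^ k * ?y ^ l)" for k l
    by (simp add: X_power mult_single add.assoc)
  have eq: "Poly_Mapping.single m c - swap i (Poly_Mapping.single m c) =
      Poly_Mapping.single m0 c * (?x ^ a * ?y ^ b - ?x ^ b * ?y ^ a)"
    unfolding swap_monomial m' by (subst m) (simp only: mono right_diff_distrib)
  have pw: "?x - ?y dvd ?x ^ k - ?y ^ k" for k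
    by (metis dvd_triv_left power_diff_sumr2)
  have "?x - ?y dvd ?x ^ a * ?y ^ b - ?x ^ b * ?y ^ a"
  proof (cases "a \<le> b")
    case True
    have "?x ^ a * ?y ^ b - ?x ^ b * ?y ^ a = - (?x ^ a * ?y ^ a * (?x ^ (b - a) - ?y ^ (b - a)))"
      using True by (simp add: algebra_simps flip: power_add)
    then show ?thesis using pw by (metis dvd_minus_iff dvd_mult)
  next
    case False
    have "?x ^ a * ?y ^ b - ?x ^ b * ?y ^ a = ?x ^ b * ?y ^ b * (?x ^ (a - b) - ?y ^ (a - b))"
      using False by (simp add: algebra_simps flip: power_add)
    then show ?thesis using pw by (metis dvd_mult)
  qed
  then show ?thesis unfolding eq by (rule dvd_mult)
qed

lemma X_diff_dvd: "(X i - X (i + 1) :: 'f::field mpoly) dvd p - swap i p"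
proof (induction p rule: update_induct)
  case const
  have "swap i (0 :: 'f mpoly) = 0" by (rule poly_mapping_eqI) (simp add: lookup_swap)
  then show ?case by simp
next
  case (update p m c)
  have "Poly_Mapping.update m c p = p + Poly_Mapping.single m c"
    using update(1) by (intro poly_mapping_eqI)
      (auto simp: lookup_update lookup_add lookup_single when_def in_keys_iff)
  then show ?case
    using dvd_add[OF update(3) X_diff_dvd_monomial[of i m c]]
    by (simp add: swap_add add_diff_add)
qed

lemma X_diff_nonzero: "(X i - X (i + 1) :: 'f::field mpoly) \<noteq> 0"
proof
  assume "X i - X (i + 1) = (0 :: 'f mpoly)"
  then have "Poly_Mapping.lookup (X i :: 'f mpoly) (Poly_Mapping.single i 1) =
      Poly_Mapping.lookup (X (i + 1) :: 'f mpoly) (Poly_Mapping.single i 1)" by simp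
  moreover have "Poly_Mapping.single (i + 1) (1::nat) \<noteq> Poly_Mapping.single i 1"
    by (metis lookup_single_eq lookup_single_not_eq n_not_Suc_n Suc_eq_plus1 zero_neq_one)
  ultimately show False by (simp add: X_def lookup_single)
qed

lemma div_diff_unique_exists:
  "\<exists>!q. q * (X i - X (i + 1)) = p - swap i (p :: 'f::field mpoly)"
proof -
  obtain q where "p - swap i p = (X i - X (i + 1)) * q"
    using X_diff_dvd by (rule dvdE)
  then show ?thesis
    using X_diff_nonzero[of i, where 'f = 'f]
    by (intro ex1I[of _ q]) (simp_all add: mult.commute[of q])
qed

lemma div_diff: "div_diff i p * (X i - X (i + 1)) = p - swap i p"
  unfolding div_diff_def by (rule theI'[OF div_diff_unique_exists])

section \<open>Hecke algebra actions\<close>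

text \<open>Operators are thought of as acting on the right: \<open>poly_T t i p\<close> is \<open>p T\<^sub>i\<close>, and similarly
  below.\<close>

definition poly_T :: "'f::field \<Rightarrow> nat \<Rightarrow> 'f mpoly \<Rightarrow> 'f mpoly" where
  "poly_T t i p = Const (1 - t) * X (i + 1) * div_diff i p + Const t * swap i p"

text \<open>The image of \<open>e S\<close> under the \<open>i\<close>-th generator, for a family \<open>e\<close> of vectors indexed by tableaux
  in a space with scalar multiplication \<open>scale\<close>. It is used both for \<open>V\<^sub>\<tau>\<close> with its defining basis
  and for polynomials with \<open>e = g\<close>. The last alternative does not occur, by \<open>tableau_cases\<close>
  below.\<close>

definition hecke_formula ::
    "('f::field \<Rightarrow> 'v::ab_group_add \<Rightarrow> 'v) \<Rightarrow> (tableau \<Rightarrow> 'v) \<Rightarrow> nat list \<Rightarrow> 'f \<Rightarrow> nat \<Rightarrow> tableau \<Rightarrow> 'v"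
  where
  "hecke_formula scale e \<tau> t i S =
    (let b = content \<tau> S i - content \<tau> S (i + 1) in
     if row \<tau> S i = row \<tau> S (i + 1) then scale t (e S)
     else if col \<tau> S i = col \<tau> S (i + 1) then - e S
     else if row \<tau> S i < row \<tau> S (i + 1) \<and> col \<tau> S i > col \<tau> S (i + 1) then
       e (exchange \<tau> i S) + scale ((t - 1) / (1 - t powi (- b))) (e S)
     else if b \<le> -2 then
       scale (t * (t powi (b + 1) - 1) * (t powi (b - 1) - 1) / (t powi b - 1)\<^sup>2) (e (exchange \<tau> i S))
       + scale (t powi b * (t - 1) / (t powi b - 1)) (e S)
     else 0)"

lemma tableau_cases:
  assumes S: "S \<in> Tab \<tau>" and i: "1 \<le> i" "i < sum_list \<tau>"
    and "row \<tau> S i \<noteq> row \<tau> S (i + 1)" "col \<tau> S i \<noteq> col \<tau> S (i + 1)"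
    and "\<not> (row \<tau> S i < row \<tau> S (i + 1) \<and> col \<tau> S i > col \<tau> S (i + 1))"
    and part: "sorted_wrt (\<ge>) \<tau>"
  shows "content \<tau> S i - content \<tau> S (i + 1) \<le> -2"
proof -
  define r c r' c' where "r = row \<tau> S i" and "c = col \<tau> S i"
    and "r' = row \<tau> S (i + 1)" and "c' = col \<tau> S (i + 1)"
  have bij: "bij_betw S (diagram \<tau>) {1..sum_list \<tau>}" using S by (simp add: Tab_def)
  have box: "box_of \<tau> S k \<in> diagram \<tau> \<and> S (box_of \<tau> S k) = k" if "k \<in> {1..sum_list \<tau>}" for k
    using that bij unfolding box_of_def bij_betw_def
    by (metis f_the_inv_into_f the_inv_into_into order_refl)
  have 1: "(r, c) \<in> diagram \<tau>" "S (r, c) = i" and 2: "(r', c') \<in> diagram \<tau>" "S (r', c') = i + 1"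
    using box[of i] box[of "i + 1"] i by (auto simp: r_def c_def r'_def c'_def row_def col_def)
  have down: "(p, q') \<in> diagram \<tau>"
    if "(p, q) \<in> diagram \<tau>" "(p', q') \<in> diagram \<tau>" "p < p'" for p q p' q'
  proof -
    have "\<tau> ! (p' - 1) \<le> \<tau> ! (p - 1)"
      using that part by (intro sorted_wrt_nth_less[of "(\<ge>)" \<tau>]) (auto simp: diagram_def)
    with that show ?thesis by (auto simp: diagram_def)
  qed
  have rows: "S (p, q') < S (p, q)" if "(p, q) \<in> diagram \<tau>" "(p, q') \<in> diagram \<tau>" "q < q'" for p q q'
    using S that by (auto simp: Tab_def)
  have cols: "S (p', q) < S (p, q)" if "(p, q) \<in> diagram \<tau>" "(p', q) \<in> diagram \<tau>" "p < p'" for p p' q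
    using S that by (auto simp: Tab_def)
  have "\<not> (r < r' \<and> c < c')"
  proof
    assume "r < r' \<and> c < c'"
    then show False
      using down[OF 1(1) 2(1)] rows[OF 1(1), of c'] cols[OF _ 2(1), of r] 1 2 by fastforce
  qed
  moreover have "\<not> (r' < r \<and> c' < c)"
  proof
    assume *: "r' < r \<and> c' < c"
    then have "(r', c) \<in> diagram \<tau>" using down[OF 2(1) 1(1)] by simp
    then show False
      using * rows[OF 2(1), of c] cols[OF _ 1(1), of r'] 1 2 by fastforce
  qed
  ultimately have "r' < r" "c < c'"
    using assms(4-6) unfolding r_def c_def r'_def c'_def by linarith+
  then show ?thesis
    unfolding content_def r_def c_def r'_def c'_def by linarith
qed

section \<open>The spaces \<open>V\<^sub>\<tau>\<close> and \<open>\<P>\<^sub>\<tau>\<close>\<close>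

text \<open>Elements of \<open>V\<^sub>\<tau>\<close> are finitely supported functions from tableaux to scalars, the basis vector
  for \<open>S\<close> being \<open>single S 1\<close>. As \<open>\<P>\<^sub>\<tau> = \<P> \<otimes> V\<^sub>\<tau>\<close> is the free \<open>\<P>\<close>-module on the basis of \<open>V\<^sub>\<tau>\<close>, its
  elements are finitely supported functions from tableaux to polynomials.\<close>

definition V_scale :: "'f::field \<Rightarrow> (tableau \<Rightarrow>\<^sub>0 'f) \<Rightarrow> (tableau \<Rightarrow>\<^sub>0 'f)" where
  "V_scale c v = Poly_Mapping.map (\<lambda>a. c * a) v"

definition tau_T :: "nat list \<Rightarrow> 'f::field \<Rightarrow> nat \<Rightarrow> tableau \<Rightarrow> (tableau \<Rightarrow>\<^sub>0 'f)" where
  "tau_T \<tau> t i S = hecke_formula V_scale (\<lambda>S. Poly_Mapping.single S 1) \<tau> t i S"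

definition P_tau :: "nat \<Rightarrow> nat list \<Rightarrow> (tableau \<Rightarrow>\<^sub>0 'f::field mpoly) set" where
  "P_tau N \<tau> = {F. Poly_Mapping.keys F \<subseteq> Tab \<tau> \<and> (\<forall>S. Poly_Mapping.lookup F S \<in> Polys N)}"

definition tensor :: "'f::field mpoly \<Rightarrow> (tableau \<Rightarrow>\<^sub>0 'f) \<Rightarrow> (tableau \<Rightarrow>\<^sub>0 'f mpoly)" where
  "tensor f v = Poly_Mapping.map (\<lambda>a. f * Const a) v"

text \<open>The operator \<open>\<^bold>T\<^sub>i\<close> on \<open>F = \<Sum>\<^sub>S f\<^sub>S \<otimes> S\<close>, \<open>f\<^sub>S = lookup F S\<close>, and the map \<open>\<rho>\<close>.\<close>

definition bold_T ::
    "nat list \<Rightarrow> 'f::field \<Rightarrow> nat \<Rightarrow> (tableau \<Rightarrow>\<^sub>0 'f mpoly) \<Rightarrow> (tableau \<Rightarrow>\<^sub>0 'f mpoly)" where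
  "bold_T \<tau> t i F = (\<Sum>S \<in> Tab \<tau>. let f = Poly_Mapping.lookup F S in
     tensor (Const (1 - t) * X (i + 1) * div_diff i f) (Poly_Mapping.single S 1)
     + tensor (swap i f) (tau_T \<tau> t i S))"

definition rho ::
    "nat list \<Rightarrow> (tableau \<Rightarrow> 'f::field mpoly) \<Rightarrow> (tableau \<Rightarrow>\<^sub>0 'f mpoly) \<Rightarrow> 'f mpoly" where
  "rho \<tau> g F = (\<Sum>S \<in> Tab \<tau>. Poly_Mapping.lookup F S * g S)"

lemma tensor_single: "tensor f (Poly_Mapping.single S 1) = Poly_Mapping.single S f"
  by (simp add: tensor_def Const_def)

lemma tensor_zero: "tensor 0 v = 0"
  by (rule poly_mapping_eqI) (simp add: tensor_def map.rep_eq when_def)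

lemma bold_T_tensor:
  assumes "S \<in> Tab \<tau>"
  shows "bold_T \<tau> t i (tensor f (Poly_Mapping.single S 1)) =
    tensor (Const (1 - t) * X (i + 1) * div_diff i f) (Poly_Mapping.single S 1)
    + tensor (swap i f) (tau_T \<tau> t i S)"
proof -
  have swap0: "swap i (0 :: 'a mpoly) = 0"
    by (rule poly_mapping_eqI) (simp add: lookup_swap)
  have div0: "div_diff i (0 :: 'a mpoly) = 0"
    using div_diff[of i "0 :: 'a mpoly"] X_diff_nonzero[of i, where 'f = 'a] by (simp add: swap0)
  have *: "(let f' = Poly_Mapping.lookup (Poly_Mapping.single S f) S' in
     tensor (Const (1 - t) * X (i + 1) * div_diff i f') (Poly_Mapping.single S' 1)
     + tensor (swap i f') (tau_T \<tau> t i S')) =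
    (if S' = S then tensor (Const (1 - t) * X (i + 1) * div_diff i f) (Poly_Mapping.single S 1)
    + tensor (swap i f) (tau_T \<tau> t i S) else 0)" for S'
    by (auto simp: lookup_single when_def swap0 div0 tensor_zero)
  show ?thesis
    unfolding bold_T_def tensor_single[of f] * using assms by (simp add: finite_Tab)
qed

lemma rho_tensor:
  assumes "S \<in> Tab \<tau>"
  shows "rho \<tau> g (tensor f (Poly_Mapping.single S 1)) = f * g S"
proof -
  have *: "Poly_Mapping.lookup (Poly_Mapping.single S f) S' * g S' = (if S' = S then f * g S else 0)"
    for S' by (auto simp: lookup_single when_def)
  show ?thesis
    unfolding rho_def tensor_single * using assms by (simp add: finite_Tab)
qed

lemma rho_add: "rho \<tau> g (F + G) = rho \<tau> g F + rho \<tau> g G"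
  by (simp add: rho_def lookup_add distrib_right sum.distrib)

lemma rho_scale: "rho \<tau> g (Poly_Mapping.map (\<lambda>f. p * f) F) = p * rho \<tau> g F"
proof -
  have "Poly_Mapping.lookup (Poly_Mapping.map (\<lambda>f. p * f) F) S = p * Poly_Mapping.lookup F S" for S
    by (simp add: map.rep_eq when_def)
  then show ?thesis by (simp add: rho_def sum_distrib_left mult.assoc)
qed

lemma Polys_add: "p \<in> Polys N \<Longrightarrow> q \<in> Polys N \<Longrightarrow> p + q \<in> Polys N"
  using keys_add[of p q] by (auto simp: Polys_def)

lemma Polys_mult: "p \<in> Polys N \<Longrightarrow> q \<in> Polys N \<Longrightarrow> p * q \<in> Polys N"
  unfolding Polys_def using keys_mult[of p q] keys_add by (fastforce dest!: subsetD)

lemma rho_in_Polys: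
  assumes "F \<in> P_tau N \<tau>" and "\<And>S. S \<in> Tab \<tau> \<Longrightarrow> g S \<in> Polys N"
  shows "rho \<tau> g F \<in> Polys N"
proof -
  have "(\<Sum>S\<in>A. Poly_Mapping.lookup F S * g S) \<in> Polys N" if "A \<subseteq> Tab \<tau>" "finite A" for A
    using that(2,1)
  proof (induction A)
    case empty
    then show ?case by (simp add: Polys_def)
  next
    case (insert S A)
    then show ?case using assms by (auto simp: P_tau_def intro!: Polys_add Polys_mult)
  qed
  then show ?thesis by (simp add: rho_def finite_Tab)
qed

section \<open>Bases of isotype \<open>\<tau>\<close>\<close>

text \<open>Invariance of \<open>M\<close> under the Hecke algebra is invariance under its generators.\<close>

definition isotype_basis ::
    "nat \<Rightarrow> nat list \<Rightarrow> 'f::field \<Rightarrow> 'f mpoly set \<Rightarrow> (tableau \<Rightarrow> 'f mpoly) \<Rightarrow> bool" where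
  "isotype_basis N \<tau> t M g \<longleftrightarrow>
     M \<subseteq> Polys N \<and> poly_space.subspace M
     \<and> (\<forall>i p. 1 \<le> i \<and> i < N \<and> p \<in> M \<longrightarrow> poly_T t i p \<in> M)
     \<and> inj_on g (Tab \<tau>) \<and> poly_space.independent (g ` Tab \<tau>) \<and> poly_space.span (g ` Tab \<tau>) = M
     \<and> (\<forall>S \<in> Tab \<tau>. \<forall>i. 1 \<le> i \<and> i < N \<longrightarrow> poly_T t i (g S) = hecke_formula poly_scale g \<tau> t i S)"

end

(* The exchange p \<mapsto> p(x s_i) is multiplicative, so the divided difference satisfies the twisted
   Leibniz rule, and therefore (f g) T_i = (1 - t) x_{i+1} (\<partial>_i f) g + f(x s_i) (g T_i). For g = g_S
   this is the image under rho of (f \<otimes> S) T_i, because the isotype hypothesis says that g_S T_i has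
   the same coefficients as S tau(T_i). *)

theory Submission
  imports Defs
begin

lemma map_key_transpose_add:
  "Poly_Mapping.map_key (transpose i (j::nat)) (m + n :: nat \<Rightarrow>\<^sub>0 nat) =
    Poly_Mapping.map_key (transpose i j) m + Poly_Mapping.map_key (transpose i j) n"
  by (rule poly_mapping_eqI) (simp add: map_key.rep_eq lookup_add)

lemma swap_zero [simp]: "swap i 0 = 0"
  by (rule poly_mapping_eqI) (simp add: lookup_swap)

lemma update_eq_add_single:
  fixes p :: "'a \<Rightarrow>\<^sub>0 'b::comm_monoid_add"
  assumes "m \<notin> Poly_Mapping.keys p"
  shows "Poly_Mapping.update m c p = p + Poly_Mapping.single m c"
  using assms
  by (intro poly_mapping_eqI)
    (auto simp: lookup_update lookup_add lookup_single when_def in_keys_iff)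

text \<open>For two monomials this is the additivity of exchanging exponents,
  \<open>map_key_transpose_add\<close>. Induction builds up the second factor here and the first
  factor in \<open>swap_mult\<close>.\<close>

lemma swap_mult_monomial:
  fixes q :: "'f::comm_ring_1 mpoly"
  shows "swap i (Poly_Mapping.single m c * q) = swap i (Poly_Mapping.single m c) * swap i q"
proof (induction q rule: update_induct)
  case const
  show ?case by simp
next
  case (update q n d)
  have "swap i (Poly_Mapping.single m c * Poly_Mapping.single n d) =
      swap i (Poly_Mapping.single m c) * swap i (Poly_Mapping.single n d)"
    by (simp only: swap_monomial mult_single map_key_transpose_add)
  with update show ?case
    by (simp add: update_eq_add_single distrib_left swap_add)
qed

lemma swap_mult:
  fixes p q :: "'f::comm_ring_1 mpoly"
  shows "swap i (p * q) = swap i p * swap i q"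
proof (induction p rule: update_induct)
  case const
  show ?case by simp
next
  case (update p m c)
  then show ?case
    by (simp add: update_eq_add_single distrib_right swap_add swap_mult_monomial)
qed

lemma div_diff_eqI: "q * (X i - X (i + 1)) = p - swap i p \<Longrightarrow> div_diff i p = q"
  using div_diff_unique_exists[of i p] div_diff[of i p] by blast

lemma div_diff_zero [simp]: "div_diff i 0 = 0"
  by (rule div_diff_eqI) simp

lemma div_diff_add: "div_diff i (p + q) = div_diff i p + div_diff i q"
  by (rule div_diff_eqI) (simp only: distrib_right div_diff swap_add add_diff_add)

text \<open>Twisted Leibniz rule: writing p' for \<open>swap i p\<close>, it comes from p q - p' q'
  = (p - p') q + p' (q - q') and uniqueness of the quotient.\<close>

lemma div_diff_mult: "div_diff i (p * q) = div_diff i p * q + swap i p * div_diff i q"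
proof (rule div_diff_eqI)
  have "(div_diff i p * q + swap i p * div_diff i q) * (X i - X (i + 1)) =
      div_diff i p * (X i - X (i + 1)) * q + swap i p * (div_diff i q * (X i - X (i + 1)))"
    by (simp only: distrib_right distrib_left mult_ac)
  also have "\<dots> = p * q - swap i (p * q)"
    by (simp only: div_diff swap_mult) (simp add: algebra_simps)
  finally show "(div_diff i p * q + swap i p * div_diff i q) * (X i - X (i + 1)) =
      p * q - swap i (p * q)" .
qed

lemma poly_T_zero [simp]: "poly_T t i 0 = 0"
  by (simp add: poly_T_def)

lemma poly_T_add: "poly_T t i (p + q) = poly_T t i p + poly_T t i q"
  by (simp add: poly_T_def div_diff_add swap_add algebra_simps)

lemma poly_T_sum: "poly_T t i (sum f A) = (\<Sum>a\<in>A. poly_T t i (f a))"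
  by (induction A rule: infinite_finite_induct) (simp_all add: poly_T_add)

text \<open>The second Leibniz term and \<open>swap i p * swap i q\<close> share the factor
  \<open>swap i p\<close>; what remains next to it is exactly \<open>poly_T t i q\<close>.\<close>

lemma poly_T_mult:
  "poly_T t i (p * q) = Const (1 - t) * X (i + 1) * div_diff i p * q + swap i p * poly_T t i q"
  by (simp add: poly_T_def div_diff_mult swap_mult algebra_simps)

text \<open>No third number lies between \<open>i\<close> and \<open>i + 1\<close>, so exchanging
  them can reverse the order of that pair only.\<close>

lemma transpose_Suc_less:
  assumes "a < b" and "\<not> (a = i \<and> b = i + 1)"
  shows "transpose i (i + 1) a < transpose i (i + 1) (b::nat)"
  using assms by (auto simp: transpose_def)

lemma box_of_eqI:
  assumes "S \<in> Tab \<tau>" and "x \<in> diagram \<tau>" and "S x = k"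
  shows "box_of \<tau> S k = x"
  using assms by (auto simp: box_of_def Tab_def bij_betw_def intro: the_inv_into_f_eq)

text \<open>The tableau conditions compare only entries in a common row or column, and
  \<open>i\<close>, \<open>i + 1\<close> share neither. The lemma is needed because
  \<open>rho\<close> sums over \<open>Tab \<tau>\<close> alone.\<close>

lemma exchange_in_Tab:
  assumes S: "S \<in> Tab \<tau>" and i: "1 \<le> i" "i < sum_list \<tau>"
    and row: "row \<tau> S i \<noteq> row \<tau> S (i + 1)" and col: "col \<tau> S i \<noteq> col \<tau> S (i + 1)"
  shows "exchange \<tau> i S \<in> Tab \<tau>"
proof -
  let ?E = "exchange \<tau> i S"
  have E: "?E x = transpose i (i + 1) (S x)" if "x \<in> diagram \<tau>" for x
    using that by (simp add: exchange_def)
  have bij: "bij_betw S (diagram \<tau>) {1..sum_list \<tau>}"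
    using S by (simp add: Tab_def)
  have "bij_betw (transpose i (i + 1) \<circ> S) (diagram \<tau>) {1..sum_list \<tau>}"
    using bij i by (intro bij_betw_trans[OF bij]) simp
  then have "bij_betw ?E (diagram \<tau>) {1..sum_list \<tau>}"
    by (rule bij_betw_cong[THEN iffD1, rotated]) (simp add: E)
  moreover have "?E (p, q') < ?E (p, q)"
    if "(p, q) \<in> diagram \<tau>" "(p, q') \<in> diagram \<tau>" "q < q'" for p q q'
  proof -
    have "S (p, q') < S (p, q)" using S that by (auto simp: Tab_def)
    \<comment> \<open>The one pair whose order would be reversed cannot occur here, since both boxes
      lie in row \<open>p\<close>.\<close>
    moreover have "\<not> (S (p, q') = i \<and> S (p, q) = i + 1)"
      using row box_of_eqI[OF S that(1)] box_of_eqI[OF S that(2)] by (auto simp: row_def)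
    ultimately show ?thesis using that by (metis E transpose_Suc_less)
  qed
  moreover have "?E (p', q) < ?E (p, q)"
    if "(p, q) \<in> diagram \<tau>" "(p', q) \<in> diagram \<tau>" "p < p'" for p p' q
  proof -
    have "S (p', q) < S (p, q)" using S that by (auto simp: Tab_def)
    moreover have "\<not> (S (p', q) = i \<and> S (p, q) = i + 1)"
      using col box_of_eqI[OF S that(1)] box_of_eqI[OF S that(2)] by (auto simp: col_def)
    ultimately show ?thesis using that by (metis E transpose_Suc_less)
  qed
  moreover have "?E \<in> extensional (diagram \<tau>)"
    by (simp add: exchange_def)
  ultimately show ?thesis by (simp add: Tab_def)
qed

lemma lookup_tensor: "Poly_Mapping.lookup (tensor f v) S = f * Const (Poly_Mapping.lookup v S)"
  by (simp add: tensor_def map.rep_eq when_def Const_def)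

lemma tensor_add: "tensor f (v + w) = tensor f v + tensor f w"
  by (rule poly_mapping_eqI)
    (simp add: lookup_tensor lookup_add Const_def single_add distrib_left)

lemma tensor_uminus: "tensor f (- v) = - tensor f v"
  by (rule poly_mapping_eqI) (simp add: lookup_tensor Const_def single_uminus)

lemma lookup_map_mult:
  fixes F :: "'a \<Rightarrow>\<^sub>0 'b::mult_zero"
  shows "Poly_Mapping.lookup (Poly_Mapping.map (\<lambda>a. c * a) F) x = c * Poly_Mapping.lookup F x"
  by (simp add: map.rep_eq when_def)

text \<open>A scalar moves from \<open>V\<close> to the polynomial coefficients, in the form to
  which \<open>rho_scale\<close> applies.\<close>

lemma tensor_V_scale:
  "tensor f (V_scale c v) = Poly_Mapping.map (\<lambda>p. Const c * p) (tensor f v)"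
proof (rule poly_mapping_eqI)
  fix S
  have "Const (c * a) = Const c * Const a" for a
    by (simp add: Const_def mult_single)
  then show "Poly_Mapping.lookup (tensor f (V_scale c v)) S =
      Poly_Mapping.lookup (Poly_Mapping.map (\<lambda>p. Const c * p) (tensor f v)) S"
    by (simp only: lookup_tensor V_scale_def lookup_map_mult mult.left_commute)
qed

lemma rho_zero: "rho \<tau> g 0 = 0"
  by (simp add: rho_def)

lemma rho_uminus: "rho \<tau> g (- F) = - rho \<tau> g F"
  by (simp add: rho_def sum_negf)

lemma rho_sum: "rho \<tau> g (sum F A) = (\<Sum>a\<in>A. rho \<tau> g (F a))"
  by (induction A rule: infinite_finite_induct) (simp_all add: rho_add rho_zero)

lemma rho_tensor_V_scale: "rho \<tau> g (tensor f (V_scale c v)) = Const c * rho \<tau> g (tensor f v)"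
  by (simp add: tensor_V_scale rho_scale)

text \<open>Both sides come from the same \<open>hecke_formula\<close>, once with the basis of
  \<open>V\<close> and once with \<open>g\<close>; additivity of \<open>rho\<close> and
  \<open>rho_tensor_V_scale\<close> carry one to the other term by term.\<close>

lemma rho_tensor_tau_T:
  assumes S: "S \<in> Tab \<tau>" and i: "1 \<le> i" "i < sum_list \<tau>"
  shows "rho \<tau> g (tensor f (tau_T \<tau> t i S)) = f * hecke_formula poly_scale g \<tau> t i S"
\<comment> \<open>Only when \<open>i\<close> and \<open>i + 1\<close> share neither row nor column
  can the formula involve the exchanged tableau.\<close>
proof (cases "row \<tau> S i = row \<tau> S (i + 1) \<or> col \<tau> S i = col \<tau> S (i + 1)")
  case True
  then show ?thesis
    using S by (auto simp: tau_T_def hecke_formula_def Let_def tensor_uminus rho_uminus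
      rho_tensor_V_scale rho_tensor poly_scale_def mult_ac)
next
  case False
  then have "exchange \<tau> i S \<in> Tab \<tau>"
    using S i by (intro exchange_in_Tab) auto
  \<comment> \<open>This covers the default alternative of \<open>hecke_formula\<close>, with value
    0 on both sides.\<close>
  moreover have "tensor f 0 = 0"
    by (rule poly_mapping_eqI) (simp add: lookup_tensor Const_def)
  ultimately show ?thesis
    using S False by (simp add: tau_T_def hecke_formula_def Let_def tensor_add rho_add
      rho_tensor_V_scale rho_tensor rho_zero poly_scale_def distrib_left mult_ac)
qed

theorem proposition3p2:
  fixes N :: nat and \<tau> :: "nat list"
    and \<iota> :: "complex \<Rightarrow> 'f::field" and t :: 'f
    and M :: "'f mpoly set" and g :: "tableau \<Rightarrow> 'f mpoly"
  assumes "N \<ge> 2" and "partition_of N \<tau>"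
    and "complex_embedding \<iota>" and "transcendental_over_complex \<iota> t"
    and "isotype_basis N \<tau> t M g"
  shows "\<forall>i. 1 \<le> i \<and> i < N \<longrightarrow>
    (\<forall>F \<in> P_tau N \<tau>. rho \<tau> g (bold_T \<tau> t i F) = poly_T t i (rho \<tau> g F))"
proof (intro allI impI ballI)
  fix i F
  assume i: "1 \<le> i \<and> i < N"
  have N: "sum_list \<tau> = N"
    using assms(2) by (simp add: partition_of_def)
  have g: "poly_T t i (g S) = hecke_formula poly_scale g \<tau> t i S" if "S \<in> Tab \<tau>" for S
    using assms(5) i that by (simp add: isotype_basis_def)
  have "rho \<tau> g (bold_T \<tau> t i F) =
      (\<Sum>S\<in>Tab \<tau>. Const (1 - t) * X (i + 1) * div_diff i (Poly_Mapping.lookup F S) * g S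
        + swap i (Poly_Mapping.lookup F S) * poly_T t i (g S))"
    unfolding bold_T_def rho_sum Let_def rho_add
    \<comment> \<open>The isotype hypothesis \<open>g\<close> rewrites
      \<open>poly_T t i (g S)\<close> into the formula produced by \<open>rho_tensor_tau_T\<close>,
      so the sums agree summand by summand.\<close>
    using i N by (intro sum.cong) (simp_all add: rho_tensor rho_tensor_tau_T g)
  \<comment> \<open>By \<open>poly_T_mult\<close>, each summand is \<open>poly_T t i\<close> of the
    coefficient of \<open>F\<close> at \<open>S\<close> times \<open>g S\<close>.\<close>
  also have "\<dots> = poly_T t i (rho \<tau> g F)"
    by (simp only: rho_def poly_T_sum poly_T_mult)
  finally show "rho \<tau> g (bold_T \<tau> t i F) = poly_T t i (rho \<tau> g F)" .
qed

end
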